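(* Let $\beta>-1$, $n\ge1$, and let $S_n(z;\beta)=z\frac{d}{dz}\ln\Delta_n(z;\beta)$ where $\Delta_n(z;\beta)=\big[\Gamma(\beta+1)\big]^n\,\mathcal{W}_n\big(z^{-\beta/2}I_\beta(2\sqrt z)\big)$. Then $S=S_n$ satisfies $$\Big(z\frac{d^2S}{dz^2}\Big)^2=\Big[n-(n+\beta)\frac{dS}{dz}\Big]^2-4\frac{dS}{dz}\Big(\frac{dS}{dz}-1\Big)\Big[z\frac{dS}{dz}-S+\tfrac12 n(n-1)\Big].$$
   Context: $I_\beta$ is the modified Bessel function of the first kind; $\delta_z= z\,\frac{d}{dz}$; for smooth $\psi$, $\mathcal{W}_n(\psi)=\det[\delta_z^{\,j+k}\psi]_{j,k=0}^{n-1}$. (This $\Delta_n$ is the Hankel determinant of moments of the weight $z^k/((\beta+1)_k k!)$ on $\mathbb{N}$.) *)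

theory Defs
  imports "HOL-Analysis.Analysis" "Jordan_Normal_Form.Determinant"
begin

text \<open>Modified Bessel function of the first kind, via its defining series
  I_nu(x) = sum_k (x/2)^(2k+nu) / (k! Gamma(k+nu+1)), for x > 0
  (1/Gamma written as rGamma, which is entire).\<close>
definition besselI :: "real \<Rightarrow> real \<Rightarrow> real" where
  "besselI \<nu> x = (\<Sum>k. (x / 2) powr (2 * real k + \<nu>) * rGamma (real k + \<nu> + 1) / fact k)"

definition delta_z :: "(real \<Rightarrow> real) \<Rightarrow> (real \<Rightarrow> real)" where
  "delta_z f = (\<lambda>z. z * deriv f z)"

definition Wn :: "nat \<Rightarrow> (real \<Rightarrow> real) \<Rightarrow> real \<Rightarrow> real" where
  "Wn n \<psi> z = det (mat n n (\<lambda>(j, k). (delta_z ^^ (j + k)) \<psi> z))"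

definition Delta_n :: "nat \<Rightarrow> real \<Rightarrow> real \<Rightarrow> real" where
  "Delta_n n \<beta> z = Gamma (\<beta> + 1) ^ n *
     Wn n (\<lambda>w. w powr (- \<beta> / 2) * besselI \<beta> (2 * sqrt w)) z"

definition S_n :: "nat \<Rightarrow> real \<Rightarrow> real \<Rightarrow> real" where
  "S_n n \<beta> z = z * deriv (\<lambda>w. ln (Delta_n n \<beta> w)) z"

end

theory Submission
  imports Defs
begin

text \<open>
  Write \<open>\<tau>\<^sub>n = det [\<delta>\<^sup>j\<^sup>+\<^sup>k \<psi>]\<close> with \<open>\<delta> = z d/dz\<close>. The Desnanot--Jacobi identity gives
  \<open>\<delta> S\<^sub>n = A\<^sub>n = \<tau>\<^sub>n\<^sub>+\<^sub>1 \<tau>\<^sub>n\<^sub>-\<^sub>1 / \<tau>\<^sub>n\<^sup>2\<close>, i.e. the Toda equations for \<open>A\<^sub>n\<close> and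
  \<open>b\<^sub>n = S\<^sub>n\<^sub>+\<^sub>1 - S\<^sub>n\<close>; the division is legitimate because \<open>\<delta>\<^sup>m \<psi>\<close> is the \<open>m\<close>-th moment of
  a positive weight on the naturals, so that \<open>\<tau>\<^sub>n > 0\<close>. The Bessel equation
  \<open>\<delta>\<^sup>2 \<psi> + \<beta> \<delta> \<psi> = z \<psi>\<close> fixes the case \<open>n = 0\<close>, and differentiating along the Toda flow
  propagates to all \<open>n\<close>, with \<open>c\<^sub>n = b\<^sub>n - n\<close> and \<open>T\<^sub>n = c\<^sub>0 + \<dots> + c\<^sub>n\<^sub>-\<^sub>1\<close>, the relations
  \<open>A\<^sub>n (c\<^sub>n + c\<^sub>n\<^sub>-\<^sub>1 + n + \<beta>) = z n\<close> and \<open>A\<^sub>n\<^sub>+\<^sub>1 + A\<^sub>n = T\<^sub>n + z - c\<^sub>n (c\<^sub>n + n + \<beta>)\<close>. They imply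
  \<open>A\<^sub>n c\<^sub>n c\<^sub>n\<^sub>-\<^sub>1 = (A\<^sub>n - z) (A\<^sub>n - T\<^sub>n)\<close>, which is the asserted equation, since
  \<open>S' = A\<^sub>n / z\<close>, \<open>z S'' = S' (c\<^sub>n - c\<^sub>n\<^sub>-\<^sub>1)\<close> and \<open>n - (n + \<beta>) S' = S' (c\<^sub>n + c\<^sub>n\<^sub>-\<^sub>1)\<close>.
\<close>

subsection \<open>Determinants\<close>

lemma det_2x2: "det (mat 2 2 f) = f (0,0) * f (1,1) - f (0,1) * f (1,0)" for f :: "nat \<times> nat \<Rightarrow> 'a::comm_ring_1"
proof -
  have "det (mat 2 2 f) = (\<Sum>i<2. mat 2 2 f $$ (i, 0) * cofactor (mat 2 2 f) i 0)"
    by (rule laplace_expansion_column) auto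
  also have "\<dots> = f (0,0) * f (1,1) - f (0,1) * f (1,0)"
    by (simp add: numeral_2_eq_2 cofactor_def mat_delete_def det_single algebra_simps)
  finally show ?thesis .
qed

text \<open>Multiply \<open>A\<close> by the identity matrix whose last two columns are replaced by
  those of the adjugate. The product is block lower triangular with lower right block
  \<open>det A\<close> times the identity; take determinants and cancel one factor
  \<open>det A\<close>.\<close>

lemma Desnanot_Jacobi:
  fixes A :: "'a::idom mat"
  assumes A: "A \<in> carrier_mat (n + 2) (n + 2)" and nz: "det A \<noteq> 0"
  shows "det (mat_delete A n n) * det (mat_delete A (Suc n) (Suc n))
           - det (mat_delete A n (Suc n)) * det (mat_delete A (Suc n) n)
         = det A * det (mat n n (\<lambda>ij. A $$ ij))"
proof -
  note adj = adj_mat[OF A]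
  define B where "B = mat (n + 2) (n + 2) (\<lambda>(i, j). if j < n then if i = j then 1 else 0 else adj_mat A $$ (i, j))"
  define M where "M = mat 2 2 (\<lambda>(i, j). adj_mat A $$ (n + i, n + j))"
  have B: "B \<in> carrier_mat (n + 2) (n + 2)" unfolding B_def by simp
  have colB: "col B j = (if j < n then col (1\<^sub>m (n + 2)) j else col (adj_mat A) j)" if "j < n + 2" for j
    using that adj(1) by (intro eq_vecI) (auto simp: B_def)
  have "B = four_block_mat (1\<^sub>m n) (mat n 2 (\<lambda>(i, j). adj_mat A $$ (i, n + j))) (0\<^sub>m 2 n) M"
    unfolding B_def M_def by (rule eq_matI) (auto simp: four_block_mat_def Let_def)
  then have detB: "det B = det M"
    using det_four_block_mat_lower_left_zero[of "1\<^sub>m n" n "mat n 2 (\<lambda>(i, j). adj_mat A $$ (i, n + j))" 2 "0\<^sub>m 2 n" M]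
    by (simp add: M_def)
  have AB: "(A * B) $$ (i, j) = (if j < n then A $$ (i, j) else if i = j then det A else 0)"
    if "i < n + 2" "j < n + 2" for i j
  proof (cases "j < n")
    case True
    have "(A * B) $$ (i, j) = (A * 1\<^sub>m (n + 2)) $$ (i, j)"
      using that A B colB[of j] True by simp
    also have "\<dots> = A $$ (i, j)" using A by simp
    finally show ?thesis using True by simp
  next
    case False
    have "(A * B) $$ (i, j) = (A * adj_mat A) $$ (i, j)"
      using that A B adj(1) colB[of j] False by simp
    then show ?thesis using that False adj(2) by auto
  qed
  have "A * B = four_block_mat (mat n n (\<lambda>ij. A $$ ij)) (0\<^sub>m n 2)
      (mat 2 n (\<lambda>(i, j). A $$ (n + i, j))) (det A \<cdot>\<^sub>m 1\<^sub>m 2)"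
    using A B by (intro eq_matI) (auto simp: AB four_block_mat_def Let_def simp del: index_mult_mat(1))
  then have "det (A * B) = det (mat n n (\<lambda>ij. A $$ ij)) * det (det A \<cdot>\<^sub>m 1\<^sub>m 2)"
    using det_four_block_mat_upper_right_zero[of "mat n n (\<lambda>ij. A $$ ij)" n "0\<^sub>m n 2" 2
        "mat 2 n (\<lambda>(i, j). A $$ (n + i, j))" "det A \<cdot>\<^sub>m 1\<^sub>m 2"] by simp
  also have "det (A * B) = det A * det M"
    using det_mult[OF A B] detB by simp
  finally have "det M = det A * det (mat n n (\<lambda>ij. A $$ ij))"
    using nz by (simp add: power2_eq_square)
  moreover have "det M = det (mat_delete A n n) * det (mat_delete A (Suc n) (Suc n))
           - det (mat_delete A n (Suc n)) * det (mat_delete A (Suc n) n)"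
    unfolding M_def det_2x2 using A by (simp add: adj_mat_def cofactor_def)
  ultimately show ?thesis by simp
qed

text \<open>The last-row cofactors \<open>v\<close> solve \<open>A v = det A e_n\<close>, so the
  quadratic form at \<open>v\<close> equals \<open>v n * det A\<close>, and \<open>v n\<close> is
  the previous determinant, positive by induction.\<close>

lemma hankel_det_pos:
  fixes m :: "nat \<Rightarrow> real"
  assumes pos: "\<And>n v. (\<exists>i<n. v i \<noteq> 0) \<Longrightarrow> 0 < (\<Sum>i<n. \<Sum>j<n. v i * v j * m (i + j))"
  shows "0 < det (mat n n (\<lambda>(i, j). m (i + j)))"
proof (induction n)
  case (Suc n)
  define A where "A = mat (Suc n) (Suc n) (\<lambda>(i, j). m (i + j))"
  have A: "A \<in> carrier_mat (Suc n) (Suc n)" unfolding A_def by simp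
  define v where "v i = cofactor A n i" for i
  have "mat_delete A n n = mat n n (\<lambda>(i, j). m (i + j))"
    unfolding A_def mat_delete_def by (rule eq_matI) auto
  then have vn: "v n > 0"
    using Suc by (simp add: v_def cofactor_def)
  have Av: "(\<Sum>j<Suc n. m (i + j) * v j) = (if i = n then det A else 0)" if "i < Suc n" for i
  proof -
    have "(A * adj_mat A) $$ (i, n) = (\<Sum>j<Suc n. m (i + j) * v j)"
      using that A unfolding adj_mat_def v_def
      by (simp add: scalar_prod_def A_def lessThan_atLeast0)
    then show ?thesis using adj_mat(2)[OF A] that by (simp split: if_splits)
  qed
  have "0 < (\<Sum>i<Suc n. \<Sum>j<Suc n. v i * v j * m (i + j))"
    using vn by (intro pos exI[of _ n]) auto
  also have "\<dots> = (\<Sum>i<Suc n. v i * (\<Sum>j<Suc n. m (i + j) * v j))"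
    by (simp only: sum_distrib_left mult_ac)
  also have "\<dots> = (\<Sum>i<Suc n. v i * (if i = n then det A else 0))"
    by (intro sum.cong refl arg_cong2[where f = "(*)"] Av) simp
  also have "\<dots> = v n * det A" by simp
  finally show ?case using vn by (simp add: zero_less_mult_iff A_def)
qed simp

text \<open>Product rule in the Leibniz expansion. The offsets \<open>r\<close> and \<open>c\<close>
  make this family of determinants closed under raising one row index.\<close>

lemma has_field_derivative_det_rows:
  fixes f :: "nat \<Rightarrow> real \<Rightarrow> real"
  assumes f: "\<And>k. (f k has_field_derivative f (Suc k) z / z) (at z)"
  shows "((\<lambda>z. det (mat n n (\<lambda>(i, j). f (r i + c j) z))) has_field_derivative
      (\<Sum>l<n. det (mat n n (\<lambda>(i, j). f ((r(l := Suc (r l))) i + c j) z))) / z) (at z)"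
proof -
  define P where "P = {p. p permutes {0..<n}}"
  have D: "det (mat n n (\<lambda>(i, j). g i j)) = (\<Sum>p\<in>P. signof p * (\<Prod>i\<in>{0..<n}. g i (p i)))"
    for g :: "nat \<Rightarrow> nat \<Rightarrow> real"
    unfolding P_def by (subst det_def'[of _ n]) (auto intro!: sum.cong prod.cong simp: permutes_nat_less)
  have "((\<lambda>z. \<Sum>p\<in>P. signof p * (\<Prod>i\<in>{0..<n}. f (r i + c (p i)) z)) has_field_derivative
      (\<Sum>p\<in>P. signof p * (\<Sum>l\<in>{0..<n}. f (Suc (r l + c (p l))) z / z * 
        (\<Prod>i\<in>{0..<n} - {l}. f (r i + c (p i)) z)))) (at z)"
    by (intro DERIV_sum DERIV_cmult has_field_derivative_prod f)
  also have "(\<Sum>p\<in>P. signof p * (\<Sum>l\<in>{0..<n}. f (Suc (r l + c (p l))) z / z * 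
        (\<Prod>i\<in>{0..<n} - {l}. f (r i + c (p i)) z)))
     = (\<Sum>p\<in>P. \<Sum>l\<in>{0..<n}. signof p * (\<Prod>i\<in>{0..<n}. f ((r(l := Suc (r l))) i + c (p i)) z) / z)"
    unfolding sum_distrib_left
  proof (intro sum.cong refl)
    fix p l assume "l \<in> {0..<n}"
    then show "signof p * (f (Suc (r l + c (p l))) z / z * (\<Prod>i\<in>{0..<n} - {l}. f (r i + c (p i)) z))
        = signof p * (\<Prod>i\<in>{0..<n}. f ((r(l := Suc (r l))) i + c (p i)) z) / z"
      by (subst prod.remove[of _ l]) (auto intro!: prod.cong)
  qed
  also have "\<dots> = (\<Sum>l\<in>{0..<n}. \<Sum>p\<in>P. signof p * (\<Prod>i\<in>{0..<n}. f ((r(l := Suc (r l))) i + c (p i)) z)) / z"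
    unfolding sum_divide_distrib by (rule sum.swap)
  finally show ?thesis
    unfolding D lessThan_atLeast0 .
qed

subsection \<open>Moments of the Bessel weight\<close>

text \<open>The weight \<open>1 / ((\<beta>+1)_k k!)\<close> divided by
  \<open>Gamma (\<beta>+1)\<close>; the power of \<open>Gamma\<close> in \<open>Delta_n\<close>
  compensates.\<close>

definition bessel_coeff :: "real \<Rightarrow> nat \<Rightarrow> real" where
  "bessel_coeff \<beta> k = rGamma (real k + \<beta> + 1) / fact k"

definition bessel_moment :: "real \<Rightarrow> nat \<Rightarrow> real \<Rightarrow> real" where
  "bessel_moment \<beta> i z = (\<Sum>k. real k ^ i * bessel_coeff \<beta> k * z ^ k)"

lemma bessel_coeff_pos: "\<beta> > -1 \<Longrightarrow> 0 < bessel_coeff \<beta> k"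
  unfolding bessel_coeff_def rGamma_inverse_Gamma by simp

lemma bessel_coeff_Suc:
  "real (Suc k) * (real (Suc k) + \<beta>) * bessel_coeff \<beta> (Suc k) = bessel_coeff \<beta> k"
proof -
  have "(real (Suc k) + \<beta>) * rGamma (real (Suc k) + \<beta> + 1) = rGamma (real k + \<beta> + 1)"
    using rGamma_plus1[of "real (Suc k) + \<beta>"] by (simp add: add_ac)
  then show ?thesis
    by (simp add: bessel_coeff_def mult.assoc del: of_nat_Suc)
qed

lemma summable_bessel_moment:
  assumes "\<beta> > -1"
  shows "summable (\<lambda>k. real k ^ i * bessel_coeff \<beta> k * z ^ k)"
proof (induction i arbitrary: z)
  case 0
  \<comment> \<open>Beyond \<open>N\<close> the factor \<open>(k+1) (k+1+\<beta>)\<close> is at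
    least \<open>2 |z|\<close>, so consecutive terms have ratio at most 1/2.\<close>
  obtain N :: nat where N: "2 * \<bar>z\<bar> + 2 < real N"
    using reals_Archimedean2 by blast
  show ?case
  proof (rule summable_ratio_test[of "1/2" N])
    fix k assume "k \<ge> N"
    then have k: "2 * \<bar>z\<bar> + 2 < real k" using N by linarith
    let ?q = "real (Suc k) * (real (Suc k) + \<beta>)"
    have "2 * \<bar>z\<bar> * 1 \<le> ?q"
      using k assms by (intro mult_mono) auto
    then have "\<bar>z\<bar> * bessel_coeff \<beta> (Suc k) * 2 \<le> ?q * bessel_coeff \<beta> (Suc k)"
      using bessel_coeff_pos[OF assms, of "Suc k"] by (simp add: mult_ac)
    then have "\<bar>z\<bar> * bessel_coeff \<beta> (Suc k) \<le> 1/2 * bessel_coeff \<beta> k"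
      by (simp only: bessel_coeff_Suc)
    from mult_right_mono[OF this, of "\<bar>z\<bar> ^ k"]
    show "norm (real (Suc k) ^ 0 * bessel_coeff \<beta> (Suc k) * z ^ Suc k)
        \<le> 1/2 * norm (real k ^ 0 * bessel_coeff \<beta> k * z ^ k)"
      using bessel_coeff_pos[OF assms, of k] bessel_coeff_pos[OF assms, of "Suc k"]
      by (simp add: abs_mult power_abs mult_ac)
  qed simp
next
  case (Suc i)
  have "summable (\<lambda>k. z * (diffs (\<lambda>k. real k ^ i * bessel_coeff \<beta> k) k * z ^ k))"
    by (intro summable_mult termdiff_converges_all Suc)
  also have "(\<lambda>k. z * (diffs (\<lambda>k. real k ^ i * bessel_coeff \<beta> k) k * z ^ k))
      = (\<lambda>k. real (Suc k) ^ Suc i * bessel_coeff \<beta> (Suc k) * z ^ Suc k)"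
    by (simp add: diffs_def mult_ac)
  finally show ?case
    by (subst (asm) summable_Suc_iff)
qed

lemma has_field_derivative_bessel_moment:
  assumes "\<beta> > -1" and "z \<noteq> 0"
  shows "(bessel_moment \<beta> i has_field_derivative bessel_moment \<beta> (Suc i) z / z) (at z)"
proof -
  let ?c = "\<lambda>k. real k ^ i * bessel_coeff \<beta> k"
  have "bessel_moment \<beta> (Suc i) z = (\<Sum>k. real (Suc k) ^ Suc i * bessel_coeff \<beta> (Suc k) * z ^ Suc k)"
    unfolding bessel_moment_def
    by (subst suminf_split_head[OF summable_bessel_moment[OF assms(1)]]) simp
  also have "\<dots> = (\<Sum>k. z * (diffs ?c k * z ^ k))"
    by (simp add: diffs_def mult_ac)
  also have "\<dots> = z * (\<Sum>k. diffs ?c k * z ^ k)"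
    by (intro suminf_mult termdiff_converges_all summable_bessel_moment assms)
  finally have "(\<Sum>k. diffs ?c k * z ^ k) = bessel_moment \<beta> (Suc i) z / z"
    using assms(2) by simp
  moreover have "((\<lambda>z. \<Sum>k. ?c k * z ^ k) has_field_derivative (\<Sum>k. diffs ?c k * z ^ k)) (at z)"
    by (intro termdiffs_strong_converges_everywhere summable_bessel_moment assms)
  ultimately show ?thesis
    unfolding bessel_moment_def by simp
qed

text \<open>The coefficient recursion read termwise: \<open>k (k + \<beta>)\<close> kills the term
  \<open>k = 0\<close>, and shifting the index produces the factor \<open>z\<close>.\<close>

lemma bessel_moment_ode:
  assumes "\<beta> > -1"
  shows "bessel_moment \<beta> 2 z + \<beta> * bessel_moment \<beta> 1 z = z * bessel_moment \<beta> 0 z"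
proof -
  note sm = summable_bessel_moment[OF assms]
  have "bessel_moment \<beta> 2 z + \<beta> * bessel_moment \<beta> 1 z
      = (\<Sum>k. real k ^ 2 * bessel_coeff \<beta> k * z ^ k + \<beta> * (real k ^ 1 * bessel_coeff \<beta> k * z ^ k))"
    unfolding bessel_moment_def
    by (intro sums_unique sums_add sums_mult summable_sums sm)
  also have "\<dots> = (\<Sum>k. real k * (real k + \<beta>) * bessel_coeff \<beta> k * z ^ k)"
    by (simp add: algebra_simps power2_eq_square)
  also have "\<dots> = (\<Sum>k. real (Suc k) * (real (Suc k) + \<beta>) * bessel_coeff \<beta> (Suc k) * z ^ Suc k)"
  proof (subst suminf_split_head)
    show "summable (\<lambda>k. real k * (real k + \<beta>) * bessel_coeff \<beta> k * z ^ k)"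
      using summable_add[OF sm[of 2 z] summable_mult[OF sm[of 1 z], of \<beta>]]
      by (simp add: algebra_simps power2_eq_square)
  qed simp
  also have "\<dots> = (\<Sum>k. z * (real k ^ 0 * bessel_coeff \<beta> k * z ^ k))"
    by (simp only: bessel_coeff_Suc) (simp add: mult_ac)
  also have "\<dots> = z * bessel_moment \<beta> 0 z"
    unfolding bessel_moment_def by (intro suminf_mult sm)
  finally show ?thesis .
qed

text \<open>The form is a weighted sum of squares of \<open>p\<close> over the naturals, and a
  nonzero polynomial cannot vanish at all of them.\<close>

lemma bessel_moment_pos_def:
  assumes "\<beta> > -1" and "z > 0" and "\<exists>i<n. v i \<noteq> 0"
  shows "0 < (\<Sum>i<n. \<Sum>j<n. v i * v j * bessel_moment \<beta> (i + j) z)"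
proof -
  note sm = summable_bessel_moment[OF assms(1)]
  define p where "p = (\<Sum>i<n. monom (v i) i)"
  let ?t = "\<lambda>k. poly p (real k) ^ 2 * (bessel_coeff \<beta> k * z ^ k)"
  have p: "poly p x = (\<Sum>i<n. v i * x ^ i)" for x
    by (simp add: p_def poly_sum poly_monom)
  have t: "?t k = (\<Sum>i<n. \<Sum>j<n. v i * v j * (real k ^ (i + j) * bessel_coeff \<beta> k * z ^ k))" for k
    unfolding p power2_eq_square sum_product sum_distrib_right
    by (intro sum.cong refl) (simp add: sum_distrib_left sum_distrib_right power_add mult_ac)
  have sums: "?t sums (\<Sum>i<n. \<Sum>j<n. v i * v j * bessel_moment \<beta> (i + j) z)"
    unfolding t bessel_moment_def by (intro sums_sum sums_mult summable_sums sm)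
  have "p \<noteq> 0"
  proof -
    obtain i where "i < n" "v i \<noteq> 0" using assms(3) by blast
    then have "coeff p i \<noteq> 0" by (simp add: p_def coeff_sum)
    then show ?thesis by auto
  qed
  then have "finite {k. poly p (real k) = 0}"
    using finite_vimageI[OF poly_roots_finite[of p], of real] by (simp add: vimage_def inj_on_def)
  then obtain k where k: "poly p (real k) \<noteq> 0"
    using ex_new_if_finite[OF infinite_UNIV_nat] by auto
  have w: "0 < bessel_coeff \<beta> k * z ^ k" for k
    using bessel_coeff_pos[OF assms(1), of k] assms(2) by simp
  have "0 < suminf ?t"
    using sums_summable[OF sums] by (rule suminf_pos2[where i = k]) (use w k in \<open>auto simp: less_imp_le\<close>)
  then show ?thesis using sums_unique[OF sums] by simp
qed

lemma besselI_eq_moment: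
  assumes "\<beta> > -1" and "z > 0"
  shows "z powr (- \<beta> / 2) * besselI \<beta> (2 * sqrt z) = bessel_moment \<beta> 0 z"
proof -
  have "(2 * sqrt z / 2) powr (2 * real k + \<beta>) = z powr (\<beta> / 2) * z ^ k" for k
    using assms by (simp add: powr_half_sqrt[symmetric] powr_powr powr_add powr_realpow add_divide_distrib mult.commute)
  then have "besselI \<beta> (2 * sqrt z) = (\<Sum>k. z powr (\<beta> / 2) * (real k ^ 0 * bessel_coeff \<beta> k * z ^ k))"
    unfolding besselI_def bessel_coeff_def by (simp add: mult_ac)
  also have "\<dots> = z powr (\<beta> / 2) * bessel_moment \<beta> 0 z"
    unfolding bessel_moment_def by (intro suminf_mult summable_bessel_moment assms)
  finally show ?thesis
    using assms by (simp add: powr_minus)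
qed

lemma delta_z_funpow_bessel:
  assumes "\<beta> > -1" and "z > 0"
  shows "(delta_z ^^ i) (\<lambda>w. w powr (- \<beta> / 2) * besselI \<beta> (2 * sqrt w)) z = bessel_moment \<beta> i z"
  using assms(2)
proof (induction i arbitrary: z)
  case (Suc i)
  have "\<forall>\<^sub>F w in nhds z. w > 0"
    using Suc.prems by (intro eventually_nhds_in_open[of "{0<..}", simplified]) auto
  then have "deriv ((delta_z ^^ i) (\<lambda>w. w powr (- \<beta> / 2) * besselI \<beta> (2 * sqrt w))) z
      = deriv (bessel_moment \<beta> i) z"
    by (intro deriv_cong_ev refl) (erule eventually_mono, rule Suc.IH)
  also have "\<dots> = bessel_moment \<beta> (Suc i) z / z"
    using has_field_derivative_bessel_moment[OF assms(1)] Suc.prems by (intro DERIV_imp_deriv) auto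
  finally show ?case
    using Suc.prems by (simp add: delta_z_def[of "(delta_z ^^ i) _"])
qed (use besselI_eq_moment[OF assms(1)] in simp)

subsection \<open>Hankel determinants and the Toda equations\<close>

lemma DERIV_cong_pos:
  fixes F G :: "real \<Rightarrow> real"
  assumes "(F has_field_derivative d) (at z)" and "z > 0" and "\<And>w. w > 0 \<Longrightarrow> F w = G w"
  shows "(G has_field_derivative d) (at z)"
  using assms(1) by (rule has_field_derivative_transform_within_open[where S = "{0<..}"])
    (use assms in auto)

text \<open>Lets an identity valid on the whole positive axis be differentiated.\<close>

lemma DERIV_eq_0_if_vanishing:
  fixes F :: "real \<Rightarrow> real"
  assumes "(F has_field_derivative d) (at z)" and "z > 0" and "\<And>w. w > 0 \<Longrightarrow> F w = 0"
  shows "d = 0"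
  using DERIV_cong_pos[OF assms(1,2), of "\<lambda>_. 0"] assms(3) by (auto dest: DERIV_unique[OF DERIV_const])

text \<open>Isolates what the Toda equations need; the Bessel equation enters only later.\<close>

locale hankel_chain =
  fixes f :: "nat \<Rightarrow> real \<Rightarrow> real"
  assumes f_deriv: "z > 0 \<Longrightarrow> (f k has_field_derivative f (Suc k) z / z) (at z)"
    and hankel_pos: "z > 0 \<Longrightarrow> 0 < det (mat n n (\<lambda>(i, j). f (i + j) z))"
begin

definition minor :: "nat \<Rightarrow> (nat \<Rightarrow> nat) \<Rightarrow> (nat \<Rightarrow> nat) \<Rightarrow> real \<Rightarrow> real" where
  "minor n r c z = det (mat n n (\<lambda>(i, j). f (r i + c j) z))"

definition hankel :: "nat \<Rightarrow> real \<Rightarrow> real" where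
  "hankel n = minor n id id"

definition S :: "nat \<Rightarrow> real \<Rightarrow> real" where
  "S n z = z * deriv (hankel n) z / hankel n z"

text \<open>The value at \<open>n = 0\<close> is the one for which the Toda equations extend to \<open>n = 0\<close>.\<close>

definition A :: "nat \<Rightarrow> real \<Rightarrow> real" where
  "A n z = (if n = 0 then 0 else hankel (Suc n) z * hankel (n - 1) z / hankel n z ^ 2)"

lemma minor_swap: "minor n r c z = minor n c r z"
proof -
  have "mat n n (\<lambda>(i, j). f (c i + r j) z) = transpose_mat (mat n n (\<lambda>(i, j). f (r i + c j) z))"
    by (rule eq_matI) (auto simp: add.commute)
  then show ?thesis
    by (simp add: minor_def det_transpose[of _ n])
qed

text \<open>Raising the index of any row but the last one produces two equal rows.\<close>

lemma minor_deriv_row: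
  assumes "z > 0"
  shows "(minor (Suc n) id c has_field_derivative minor (Suc n) (id(n := Suc n)) c z / z) (at z)"
proof -
  have "minor (Suc n) (id(l := Suc l)) c z = 0" if "l < n" for l
    unfolding minor_def using that
    by (intro det_identical_rows[where i = l and j = "Suc l" and n = "Suc n"]) auto
  then have "(\<Sum>l<Suc n. minor (Suc n) (id(l := Suc l)) c z) = minor (Suc n) (id(n := Suc n)) c z"
    by (simp del: fun_upd_apply)
  moreover have "(minor (Suc n) id c has_field_derivative
      (\<Sum>l<Suc n. minor (Suc n) (id(l := Suc l)) c z) / z) (at z)"
    using has_field_derivative_det_rows[of f z "Suc n" id c, OF f_deriv[OF assms]]
    by (simp only: minor_def[abs_def] id_apply)
  ultimately show ?thesis by (simp only:)
qed

lemma hankel_gt_0: "z > 0 \<Longrightarrow> 0 < hankel n z"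
  using hankel_pos by (simp add: hankel_def minor_def)

lemma hankel_0 [simp]: "hankel 0 z = 1"
  by (simp add: hankel_def minor_def)

text \<open>Deleting row \<open>n\<close> instead of row \<open>Suc n\<close> from the Hankel matrix
  of size \<open>n + 2\<close> leaves the last row index raised, so the Desnanot--Jacobi minors stay
  in this family.\<close>

lemma minor_Jacobi:
  fixes n :: nat
  assumes "z > 0"
  defines "s \<equiv> id(n := Suc n)"
  shows "minor (Suc n) s s z * hankel (Suc n) z - minor (Suc n) s id z ^ 2
       = hankel (n + 2) z * hankel n z"
proof -
  define M where "M = mat (n + 2) (n + 2) (\<lambda>(i, j). f (i + j) z)"
  have [simp]: "det (mat_delete M n n) = minor (Suc n) s s z"
    "det (mat_delete M n (Suc n)) = minor (Suc n) s id z"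
    "det (mat_delete M (Suc n) n) = minor (Suc n) id s z"
    "det (mat_delete M (Suc n) (Suc n)) = hankel (Suc n) z"
    unfolding minor_def hankel_def
    by (intro arg_cong[where f = det] eq_matI; auto simp: M_def mat_delete_def s_def)+
  have "det M = hankel (n + 2) z" "det (mat n n (\<lambda>ij. M $$ ij)) = hankel n z"
    unfolding minor_def hankel_def
    by (intro arg_cong[where f = det] eq_matI; auto simp: M_def)+
  moreover have "M \<in> carrier_mat (n + 2) (n + 2)" by (simp add: M_def)
  ultimately show ?thesis
    using Desnanot_Jacobi[of M n] hankel_gt_0[OF assms(1), of "n + 2"]
    by (simp add: minor_swap[of _ id s] power2_eq_square)
qed

lemma hankel_deriv:
  assumes "z > 0"
  shows "(hankel n has_field_derivative S n z * hankel n z / z) (at z)"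
proof -
  have "\<exists>d. (hankel n has_field_derivative d) (at z)"
  proof (cases n)
    case 0
    then show ?thesis by (auto simp: hankel_0[abs_def] intro!: exI[of _ 0])
  next
    case (Suc k)
    then show ?thesis using minor_deriv_row[OF assms] by (auto simp: hankel_def)
  qed
  then have "(hankel n has_field_derivative deriv (hankel n) z) (at z)"
    using DERIV_imp_deriv by blast
  then show ?thesis
    using hankel_gt_0[OF assms, of n] assms by (simp add: S_def)
qed

lemma S_0 [simp]: "S 0 z = 0"
  by (simp add: S_def hankel_0[abs_def])

lemma S_Suc:
  assumes "z > 0"
  shows "S (Suc n) z = minor (Suc n) (id(n := Suc n)) id z / hankel (Suc n) z"
  using DERIV_imp_deriv[OF minor_deriv_row[OF assms, of n id]] assms
  by (simp add: S_def hankel_def)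

text \<open>In the quotient rule for \<open>?V / ?T\<close>, \<open>?V\<close> and \<open>?W\<close>
  are the first and second \<open>z d/dz\<close> derivatives of \<open>?T\<close>, so the numerator
  is the left side of \<open>minor_Jacobi\<close>.\<close>

lemma S_deriv:
  assumes "z > 0"
  shows "(S n has_field_derivative A n z / z) (at z)"
proof (cases n)
  case 0
  then show ?thesis by (simp add: A_def S_0[abs_def])
next
  case (Suc k)
  let ?s = "id(k := Suc k)"
  let ?V = "minor (Suc k) ?s id" and ?W = "minor (Suc k) ?s ?s" and ?T = "hankel (Suc k)"
  have V: "(?V has_field_derivative ?W z / z) (at z)"
    using minor_deriv_row[OF assms, of k ?s] by (simp add: minor_swap[of _ id, abs_def])
  have T: "(?T has_field_derivative ?V z / z) (at z)"
    using minor_deriv_row[OF assms, of k id] by (simp add: hankel_def)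
  have nz: "?T z \<noteq> 0" using hankel_gt_0[OF assms, of "Suc k"] by simp
  have "((\<lambda>w. ?V w / ?T w) has_field_derivative
      (?W z / z * ?T z - ?V z * (?V z / z)) / (?T z * ?T z)) (at z)"
    by (rule DERIV_divide[OF V T nz])
  also have "(?W z / z * ?T z - ?V z * (?V z / z)) / (?T z * ?T z)
      = (?W z * ?T z - ?V z ^ 2) / (?T z) ^ 2 / z"
    using nz assms by (simp add: field_simps power2_eq_square)
  also have "\<dots> = A n z / z"
    using minor_Jacobi[OF assms, of k] by (simp add: A_def Suc)
  finally show ?thesis
    by (rule DERIV_cong_pos[OF _ assms]) (simp only: Suc S_Suc)
qed

lemma A_0 [simp]: "A 0 z = 0"
  by (simp add: A_def)

lemma A_Suc_pos: "z > 0 \<Longrightarrow> 0 < A (Suc n) z"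
  by (simp add: A_def) (intro divide_pos_pos mult_pos_pos zero_less_power hankel_gt_0)

text \<open>Logarithmic differentiation of the quotient. At \<open>n = 0\<close> the truncated
  \<open>n - 1\<close> is harmless because \<open>A 0\<close> vanishes.\<close>

lemma A_deriv:
  assumes "z > 0"
  shows "(A n has_field_derivative A n z * (S (Suc n) z + S (n - 1) z - 2 * S n z) / z) (at z)"
proof (cases n)
  case 0
  then show ?thesis by (simp add: A_0[abs_def])
next
  case (Suc k)
  have nz: "hankel m z \<noteq> 0" for m using hankel_gt_0[OF assms, of m] by simp
  have "((\<lambda>w. hankel (Suc n) w * hankel (n - 1) w / hankel n w ^ 2) has_field_derivative
      A n z * (S (Suc n) z + S (n - 1) z - 2 * S n z) / z) (at z)"
    by (rule DERIV_cong[OF DERIV_divide[OF DERIV_mult[OF hankel_deriv hankel_deriv] DERIV_power[OF hankel_deriv]]])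
      (use assms nz in \<open>simp_all add: A_def Suc field_simps power2_eq_square\<close>)
  then show ?thesis by (simp add: A_def[abs_def] Suc)
qed

end

subsection \<open>Discrete relations and the sigma form\<close>

locale bessel_hankel = hankel_chain +
  fixes \<beta> :: real
  assumes ode: "z > 0 \<Longrightarrow> f 2 z + \<beta> * f 1 z = z * f 0 z"
begin

definition c :: "nat \<Rightarrow> real \<Rightarrow> real" where
  "c n z = S (Suc n) z - S n z - real n"

definition T :: "nat \<Rightarrow> real \<Rightarrow> real" where
  "T n z = S n z - real n * (real n - 1) / 2"

lemma c_deriv:
  assumes "z > 0"
  shows "(c n has_field_derivative (A (Suc n) z - A n z) / z) (at z)"
  unfolding c_def[abs_def]
  by (auto intro!: derivative_eq_intros S_deriv assms simp: diff_divide_distrib)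

lemma T_deriv: "z > 0 \<Longrightarrow> (T n has_field_derivative A n z / z) (at z)"
  unfolding T_def[abs_def] by (auto intro!: derivative_eq_intros S_deriv)

lemma T_0 [simp]: "T 0 z = 0"
  by (simp add: T_def)

lemma T_Suc: "T (Suc n) z = T n z + c n z"
  by (simp add: T_def c_def field_simps)

text \<open>Base case, where the Bessel equation enters: it eliminates \<open>f 2\<close> from the
  derivative of \<open>S 1 = f 1 / f 0\<close>.\<close>

lemma A_1:
  assumes "z > 0"
  shows "A 1 z = z - c 0 z * (c 0 z + \<beta>)"
proof -
  have f0: "0 < f 0 z" using hankel_pos[OF assms, of 1] by (simp add: det_single)
  have h1: "hankel 1 = f 0" by (rule ext) (simp add: hankel_def minor_def det_single)
  have S1: "S 1 w = f 1 w / f 0 w" if "w > 0" for w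
    using DERIV_imp_deriv[OF f_deriv[OF that, of 0]] that unfolding S_def h1 by simp
  have "((\<lambda>w. f 1 w / f 0 w) has_field_derivative
      (f (Suc 1) z / z * f 0 z - f 1 z * (f 1 z / z)) / (f 0 z * f 0 z)) (at z)"
    using f_deriv[OF assms, of 0] f_deriv[OF assms, of 1] f0 by (intro DERIV_divide) auto
  moreover have "((\<lambda>w. f 1 w / f 0 w) has_field_derivative A 1 z / z) (at z)"
    using S_deriv[OF assms] assms by (rule DERIV_cong_pos) (rule S1)
  ultimately have "A 1 z / z = (f (Suc 1) z / z * f 0 z - f 1 z * (f 1 z / z)) / (f 0 z * f 0 z)"
    by (rule DERIV_unique[rotated])
  then have "A 1 z = (f 2 z * f 0 z - f 1 z ^ 2) / f 0 z ^ 2"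
    using assms f0 by (simp add: field_simps power2_eq_square numeral_2_eq_2)
  also have "f 2 z = z * f 0 z - \<beta> * f 1 z"
    using ode[OF assms] by simp
  finally have "A 1 z = z - f 1 z / f 0 z * (f 1 z / f 0 z + \<beta>)"
    using f0 by (simp add: field_simps power2_eq_square)
  then show ?thesis
    using S1[OF assms] by (simp add: c_def)
qed

text \<open>Differentiating the second relation gives the first one for \<open>Suc n\<close>, and
  differentiating that one gives the second one for \<open>Suc n\<close>.\<close>

lemma Laguerre_Freud:
  assumes "z > 0"
  shows "A n z * (S (Suc n) z - S (n - 1) z - real n + 1 + \<beta>) = z * real n"
    and "A (Suc n) z + A n z = T n z + z - c n z * (c n z + real n + \<beta>)"
  using assms
proof (induction n arbitrary: z)
  case 0
  { case 1 show ?case by simp }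
  { case 2 then show ?case using A_1[OF 2] by simp }
next
  case (Suc n)
  have L: "A (Suc n) z * (S (Suc (Suc n)) z - S n z - real n + \<beta>) = z * (real n + 1)" if "z > 0" for z
  proof -
    let ?F = "\<lambda>z. A (Suc n) z + A n z - (T n z + z - c n z * (c n z + real n + \<beta>))"
    let ?d = "A (Suc n) z * (S (Suc (Suc n)) z + S n z - 2 * S (Suc n) z)
      + A n z * (S (Suc n) z + S (n - 1) z - 2 * S n z) - A n z - z
      + (A (Suc n) z - A n z) * (2 * c n z + real n + \<beta>)"
    have "(?F has_field_derivative ?d / z) (at z)"
      using that
      by (auto intro!: derivative_eq_intros A_deriv T_deriv c_deriv)
        (simp add: field_simps)
    then have "?d / z = 0"
      by (rule DERIV_eq_0_if_vanishing) (use that Suc.IH(2) in auto)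
    then have "?d = 0" using that by simp
    \<comment> \<open>The derivative splits into the left sides of the first relation at
      \<open>Suc n\<close> and at \<open>n\<close>; the latter equals \<open>z n\<close>.\<close>
    moreover have "?d = A (Suc n) z * (S (Suc (Suc n)) z - S n z - real n + \<beta>)
       - A n z * (S (Suc n) z - S (n - 1) z - real n + 1 + \<beta>) - z"
      by (simp add: c_def algebra_simps)
    ultimately show ?thesis
      using Suc.IH(1)[OF that] by (simp add: algebra_simps)
  qed
  { case 1 then show ?case using L[OF 1] by (simp add: algebra_simps) }
  { case 2
    let ?a = "A (Suc n) z" and ?E = "S (Suc (Suc n)) z - S n z - real n + \<beta>"
    let ?d = "?a * (S (Suc (Suc n)) z + S n z - 2 * S (Suc n) z) * ?E
      + ?a * (A (Suc (Suc n)) z - A n z) - z * (real n + 1)"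
    have "((\<lambda>z. A (Suc n) z * (S (Suc (Suc n)) z - S n z - real n + \<beta>) - z * (real n + 1))
        has_field_derivative ?d / z) (at z)"
      using 2
      by (auto intro!: derivative_eq_intros A_deriv S_deriv) (simp add: field_simps)
    then have "?d / z = 0"
      by (rule DERIV_eq_0_if_vanishing) (use 2 L in auto)
    then have "?d = 0" using 2 by simp
    \<comment> \<open>Replacing \<open>z (n + 1)\<close> by \<open>?a * ?E\<close> makes the
      positive \<open>?a\<close> a common factor, which can be cancelled.\<close>
    then have "?a * ((S (Suc (Suc n)) z + S n z - 2 * S (Suc n) z) * ?E
        + (A (Suc (Suc n)) z - A n z) - ?E) = 0"
      using L[OF 2] by (simp add: algebra_simps)
    then have *: "(S (Suc (Suc n)) z + S n z - 2 * S (Suc n) z) * ?E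
        + (A (Suc (Suc n)) z - A n z) - ?E = 0"
      using A_Suc_pos[OF 2, of n] by simp
    \<comment> \<open>The summand 1 cancels \<open>- ?E\<close>; what remains of the product is the
      difference of \<open>x (x + n + 1 + \<beta>)\<close> at \<open>c (Suc n) z\<close> and
      \<open>c n z\<close>, which telescopes against the induction hypothesis.\<close>
    have c: "S (Suc (Suc n)) z + S n z - 2 * S (Suc n) z = c (Suc n) z - c n z + 1"
      "?E = c (Suc n) z + c n z + real n + 1 + \<beta>"
      by (simp_all add: c_def)
    show ?case
      using Suc.IH(2)[OF 2] *[unfolded c] unfolding T_Suc by (simp add: algebra_simps) }
qed

text \<open>The induction goes through the companion relation
  \<open>(A\<^sub>n - z) (A\<^sub>n\<^sub>+\<^sub>1 - z) = z c\<^sub>n (c\<^sub>n + \<beta>)\<close>,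
  which links consecutive \<open>n\<close>.\<close>

lemma first_integral:
  assumes "z > 0"
  shows "A n z * c n z * (S n z - S (n - 1) z - real n + 1) = (A n z - z) * (A n z - T n z)"
proof (induction n)
  case (Suc n)
  note LF = Laguerre_Freud[OF assms, of n]
  have "(A n z - z) * (A n z - T n z) = c n z * (A n z * (S n z - S (n - 1) z - real n + 1))"
    using Suc by (simp add: mult_ac)
  also have "A n z * (S n z - S (n - 1) z - real n + 1) = z * real n - A n z * (c n z + real n + \<beta>)"
    using LF(1) by (simp add: c_def algebra_simps)
  finally have "(A n z - z) * (A n z - T n z) = c n z * (z * real n - A n z * (c n z + real n + \<beta>))" .
  moreover have "A n z - T n z = z - A (Suc n) z - c n z * (c n z + real n + \<beta>)"
    using LF(2) by simp
  ultimately have R: "(A n z - z) * (A (Suc n) z - z) = z * c n z * (c n z + \<beta>)"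
    by (simp add: algebra_simps)
  have "(A (Suc n) z - z) * (A (Suc n) z - T (Suc n) z)
      = (A (Suc n) z - z) * (z - A n z - c n z * (c n z + real n + 1 + \<beta>))"
  proof -
    have "A (Suc n) z - T (Suc n) z = z - A n z - c n z * (c n z + real n + 1 + \<beta>)"
      using LF(2) by (simp add: T_Suc algebra_simps)
    then show ?thesis by simp
  qed
  \<comment> \<open>The companion relation \<open>R\<close> turns the product of the two
    \<open>z\<close>-shifted factors into a multiple of \<open>c n z\<close>.\<close>
  also have "\<dots> = c n z * (z * (real n + 1) - A (Suc n) z * (c n z + real n + 1 + \<beta>))"
    using R by (simp add: algebra_simps)
  also have "z * (real n + 1) - A (Suc n) z * (c n z + real n + 1 + \<beta>) = A (Suc n) z * c (Suc n) z"
    using Laguerre_Freud(1)[OF assms, of "Suc n"] by (simp add: c_def algebra_simps)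
  finally show ?case by (simp add: c_def mult_ac)
qed simp

lemma sigma_form:
  assumes "z > 0" and "n \<ge> 1"
  shows "(z * deriv (deriv (S n)) z) ^ 2 =
     (real n - (real n + \<beta>) * deriv (S n) z) ^ 2
     - 4 * deriv (S n) z * (deriv (S n) z - 1)
         * (z * deriv (S n) z - S n z + real n * (real n - 1) / 2)"
proof -
  define y where "y = A n z / z"
  \<comment> \<open>Since \<open>n \<ge> 1\<close>, this is \<open>c (n - 1) z\<close>.\<close>
  define c' where "c' = S n z - S (n - 1) z - real n + 1"
  have A: "A n z = z * y" using assms by (simp add: y_def)
  have S': "deriv (S n) w = A n w / w" if "w > 0" for w
    using S_deriv[OF that] by (rule DERIV_imp_deriv)
  have "((\<lambda>w. A n w / w) has_field_derivative
      (A n z * (S (Suc n) z + S (n - 1) z - 2 * S n z) / z * z - A n z * 1) / (z * z)) (at z)"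
    using assms by (intro DERIV_divide A_deriv DERIV_ident) auto
  then have "(deriv (S n) has_field_derivative
      (A n z * (S (Suc n) z + S (n - 1) z - 2 * S n z) / z * z - A n z * 1) / (z * z)) (at z)"
    using assms(1) by (rule DERIV_cong_pos) (simp add: S')
  then have "z * deriv (deriv (S n)) z
      = z * ((A n z * (S (Suc n) z + S (n - 1) z - 2 * S n z) / z * z - A n z * 1) / (z * z))"
    by (simp add: DERIV_imp_deriv)
  also have "\<dots> = y * (c n z - c')"
    using assms unfolding A by (simp add: c_def c'_def field_simps)
  finally have 1: "z * deriv (deriv (S n)) z = y * (c n z - c')" .
  have "z * (real n - (real n + \<beta>) * y) = z * (y * (c n z + c'))"
    using Laguerre_Freud(1)[OF assms(1), of n] unfolding A by (simp add: c_def c'_def algebra_simps)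
  then have 2: "real n - (real n + \<beta>) * y = y * (c n z + c')"
    using assms by simp
  have "z * (y * c n z * c') = z * ((y - 1) * (z * y - T n z))"
    using first_integral[OF assms(1), of n] unfolding A c'_def by (simp add: algebra_simps)
  then have 3: "y * c n z * c' = (y - 1) * (z * y - T n z)"
    using assms by simp
  \<comment> \<open>Uses \<open>(c - c')^2 = (c + c')^2 - 4 c c'\<close>, so that \<open>2\<close>
    and \<open>3\<close> supply the two terms of the equation.\<close>
  have "(z * deriv (deriv (S n)) z) ^ 2 = (y * (c n z + c')) ^ 2 - 4 * y * (y * c n z * c')"
    unfolding 1 by (simp add: power2_eq_square algebra_simps)
  also have "\<dots> = (real n - (real n + \<beta>) * y) ^ 2
      - 4 * y * (y - 1) * (z * y - S n z + real n * (real n - 1) / 2)"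
    unfolding 2[symmetric] 3 T_def by (simp only: mult.assoc diff_diff_eq2 diff_add_eq)
  finally show ?thesis
    unfolding S'[OF assms(1)] y_def[symmetric] .
qed

end

section \<open>Transfer to the Bessel determinants\<close>

theorem theorem4p4:
  fixes \<beta> z :: real and n :: nat
  assumes "\<beta> > -1" and "n \<ge> 1" and "z > 0"
  shows "(z * deriv (deriv (S_n n \<beta>)) z) ^ 2 =
           (real n - (real n + \<beta>) * deriv (S_n n \<beta>) z) ^ 2
           - 4 * deriv (S_n n \<beta>) z * (deriv (S_n n \<beta>) z - 1)
               * (z * deriv (S_n n \<beta>) z - S_n n \<beta> z + real n * (real n - 1) / 2)"
proof -
  interpret bessel_hankel "bessel_moment \<beta>" \<beta>
  proof
    fix z :: real and n k
    assume z: "z > 0"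
    show "(bessel_moment \<beta> k has_field_derivative bessel_moment \<beta> (Suc k) z / z) (at z)"
      using has_field_derivative_bessel_moment[OF assms(1)] z by simp
    show "0 < det (mat n n (\<lambda>(i, j). bessel_moment \<beta> (i + j) z))"
      by (intro hankel_det_pos bessel_moment_pos_def[OF assms(1) z])
    show "bessel_moment \<beta> 2 z + \<beta> * bessel_moment \<beta> 1 z = z * bessel_moment \<beta> 0 z"
      by (rule bessel_moment_ode[OF assms(1)])
  qed
  have Delta: "Delta_n n \<beta> w = Gamma (\<beta> + 1) ^ n * hankel n w" if "w > 0" for w
    using delta_z_funpow_bessel[OF assms(1) that]
    by (simp add: Delta_n_def Wn_def hankel_def minor_def)
  have G: "Gamma (\<beta> + 1) > 0" using assms(1) by simp
  have S_n_eq: "S_n n \<beta> w = S n w" if w: "w > 0" for w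
  proof -
    have h: "0 < hankel n w" by (rule hankel_gt_0[OF w])
    \<comment> \<open>The constant positive factor drops out of the logarithmic derivative.\<close>
    have "((\<lambda>w. ln (Gamma (\<beta> + 1) ^ n * hankel n w)) has_field_derivative S n w / w) (at w)"
      using G h w by (auto intro!: derivative_eq_intros hankel_deriv simp: field_simps)
    then have "((\<lambda>w. ln (Delta_n n \<beta> w)) has_field_derivative S n w / w) (at w)"
      using w by (rule DERIV_cong_pos) (simp add: Delta)
    then show ?thesis
      using w by (simp add: S_n_def DERIV_imp_deriv)
  qed
  have ev: "\<forall>\<^sub>F w in nhds u. w > 0" if "u > 0" for u :: real
    using that by (intro eventually_nhds_in_open[of "{0<..}", simplified]) auto
  \<comment> \<open>Equality at every positive point, not only at \<open>z\<close>, is needed to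
    differentiate once more.\<close>
  have d1: "deriv (S_n n \<beta>) w = deriv (S n) w" if "w > 0" for w
    by (intro deriv_cong_ev refl eventually_mono[OF ev[OF that]] S_n_eq)
  have d2: "deriv (deriv (S_n n \<beta>)) z = deriv (deriv (S n)) z"
    by (intro deriv_cong_ev refl eventually_mono[OF ev[OF assms(3)]] d1)
  show ?thesis
    unfolding d2 d1[OF assms(3)] S_n_eq[OF assms(3)]
    by (rule sigma_form[OF assms(3,2)])
qed

end
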